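(* (Arimoto's Mrs. Gerber's Lemma) Let $\delta\in[0,1]$, $0\le q\le\tfrac12$ and $\beta\ge 2$ (real). Let $X\in\{0,1\}$ with $\Pr(X=1)=q$, and let $Y$ be the output of the binary symmetric channel with crossover probability $\delta$ and input $X$. For $K_\beta(q)\le x\le 1$ let $L_{\mathbf T}(q,x)$ be the minimum of $K_\beta(Y|W)$ over all discrete random variables $W$ with $W\to X\to Y$ and $K_\beta(X|W)=x$, and let $\mathcal L^{(\beta)}=\{(x,L_{\mathbf T}(q,x)) : K_\beta(q)\le x\le 1\}$. Then $$\mathcal L^{(\beta)}=\left\{\left(K_\beta(p),\,K_\beta(p\star\delta)\right) : 0\le p\le q\right\}.$$ In particular, for every $(x,y)\in\mathcal L^{(\beta)}$, $$\frac{\beta}{1-\beta}\log y=\min\left\{H_\beta(Y|W) : W\to X\to Y,\ H_\beta(X|W)\ge\frac{\beta}{1-\beta}\log x\right\}.$$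
   Context: For $a,b\in[0,1]$, $a\star b=(1-a)b+(1-b)a$. The binary symmetric channel with crossover probability $\delta$ has $P_{Y|X}(1|0)=P_{Y|X}(0|1)=\delta$. $W\to X\to Y$ means that $W$ and $Y$ are conditionally independent given $X$; the joint law of $(X,Y)$ is fixed and $W$ varies over discrete random variables. For a finite-valued random variable $X$ and discrete $W$, the Arimoto conditional entropy of order $\beta$ is $H_\beta(X|W)=\frac{\beta}{1-\beta}\log\sum_w P_W(w)\,\|P_{X|W=w}\|_\beta$, where $\|\cdot\|_\beta$ is the $\ell^\beta$ norm of the probability vector; $H_\beta(X)=\frac{\beta}{1-\beta}\log\|P_X\|_\beta$ is the Rényi entropy. Set $K_\beta(X|W)=\exp\{\frac{1-\beta}{\beta}H_\beta(X|W)\}=\sum_w P_W(w)\|P_{X|W=w}\|_\beta$ and $K_\beta(X)=\exp\{\frac{1-\beta}{\beta}H_\beta(X)\}=\|P_X\|_\beta$; similarly for $Y$. For $p\in[0,1]$, $K_\beta(p)$ denotes $K_\beta$ of a Bernoulli$(p)$ variable, i.e. $K_\beta(p)=(p^\beta+(1-p)^\beta)^{1/\beta}$. Logarithms are natural.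
   Formalization: The "in particular" clause is proved with max in place of min and H_β(X|W) ≤ in place of ≥, since β/(1−β)<0 reverses both; as printed it fails, e.g. for β=2, q=1/2, δ=1/4. *)

theory Defs
  imports "HOL-Probability.Probability"
begin

definition bin_conv :: "real \<Rightarrow> real \<Rightarrow> real" (infixl "\<star>" 70) where
  "a \<star> b = (1 - a) * b + (1 - b) * a"

definition is_minimum :: "real \<Rightarrow> real set \<Rightarrow> bool" where
  "is_minimum m S \<longleftrightarrow> m \<in> S \<and> (\<forall>s\<in>S. m \<le> s)"

definition is_maximum :: "real \<Rightarrow> real set \<Rightarrow> bool" where
  "is_maximum m S \<longleftrightarrow> m \<in> S \<and> (\<forall>s\<in>S. s \<le> m)"

definition lnorm_pmf :: "real \<Rightarrow> 'a::finite pmf \<Rightarrow> real" where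
  "lnorm_pmf \<beta> p = (\<Sum>x\<in>UNIV. pmf p x powr \<beta>) powr (1 / \<beta>)"

text \<open>For a joint law \<open>P\<close> of \<open>(W, X)\<close>, \<open>arimoto_K \<beta> P\<close> is \<open>K\<^sub>\<beta>(X|W)\<close>, the sum over
  \<open>w\<close> of \<open>P\<^sub>W(w)\<close> times the norm of \<open>P\<close> conditioned on \<open>W = w\<close>; the conditional law
  matters only for \<open>w\<close> in the support of \<open>W\<close>.\<close>

definition arimoto_K :: "real \<Rightarrow> ('w \<times> 'a::finite) pmf \<Rightarrow> real" where
  "arimoto_K \<beta> P = measure_pmf.expectation (map_pmf fst P)
     (\<lambda>w. lnorm_pmf \<beta> (map_pmf snd (cond_pmf P {(w', x). w' = w})))"

definition arimoto_entropy :: "real \<Rightarrow> ('w \<times> 'a::finite) pmf \<Rightarrow> real" where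
  "arimoto_entropy \<beta> P = \<beta> / (1 - \<beta>) * ln (arimoto_K \<beta> P)"

definition bernoulli_K :: "real \<Rightarrow> real \<Rightarrow> real" where
  "bernoulli_K \<beta> p = (p powr \<beta> + (1 - p) powr \<beta>) powr (1 / \<beta>)"

definition bsc :: "real \<Rightarrow> bool \<Rightarrow> bool pmf" where
  "bsc \<delta> x = (if x then bernoulli_pmf (1 - \<delta>) else bernoulli_pmf \<delta>)"

definition bsc_joint :: "real \<Rightarrow> real \<Rightarrow> (bool \<times> bool) pmf" where
  "bsc_joint q \<delta> = bind_pmf (bernoulli_pmf q) (\<lambda>x. map_pmf (Pair x) (bsc \<delta> x))"

text \<open>\<open>W \<rightarrow> X \<rightarrow> Y\<close>: given each value of \<open>X\<close> of positive probability, the law of \<open>(W, Y)\<close> is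
  the product of its marginals.\<close>

definition markov_chain :: "('w \<times> 'a \<times> 'b) pmf \<Rightarrow> bool" where
  "markov_chain P \<longleftrightarrow>
     (\<forall>x \<in> set_pmf (map_pmf (\<lambda>(w, x, y). x) P).
        let C = cond_pmf P {(w, x', y). x' = x}
        in map_pmf (\<lambda>(w, x, y). (w, y)) C =
           pair_pmf (map_pmf (\<lambda>(w, x, y). w) C) (map_pmf (\<lambda>(w, x, y). y) C))"

text \<open>Joint laws of \<open>(W, X, Y)\<close> that extend a fixed law \<open>Q\<close> of \<open>(X, Y)\<close>. A discrete \<open>W\<close>
  has countable support and only its joint law with \<open>(X, Y)\<close> matters, so its values can be
  labelled by natural numbers.\<close>

definition markov_extensions :: "('a \<times> 'b) pmf \<Rightarrow> (nat \<times> 'a \<times> 'b) pmf set" where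
  "markov_extensions Q = {P. map_pmf snd P = Q \<and> markov_chain P}"

definition law_WX :: "('w \<times> 'a \<times> 'b) pmf \<Rightarrow> ('w \<times> 'a) pmf" where
  "law_WX P = map_pmf (\<lambda>(w, x, y). (w, x)) P"

definition law_WY :: "('w \<times> 'a \<times> 'b) pmf \<Rightarrow> ('w \<times> 'b) pmf" where
  "law_WY P = map_pmf (\<lambda>(w, x, y). (w, y)) P"

definition K_values :: "real \<Rightarrow> real \<Rightarrow> real \<Rightarrow> real \<Rightarrow> real set" where
  "K_values \<beta> \<delta> q x =
     {arimoto_K \<beta> (law_WY P) | P.
        P \<in> markov_extensions (bsc_joint q \<delta>) \<and> arimoto_K \<beta> (law_WX P) = x}"

definition L_T :: "real \<Rightarrow> real \<Rightarrow> real \<Rightarrow> real \<Rightarrow> real" where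
  "L_T \<beta> \<delta> q x = (LEAST k. k \<in> K_values \<beta> \<delta> q x)"

definition L_curve :: "real \<Rightarrow> real \<Rightarrow> real \<Rightarrow> (real \<times> real) set" where
  "L_curve \<beta> \<delta> q = {(x, L_T \<beta> \<delta> q x) | x. bernoulli_K \<beta> q \<le> x \<and> x \<le> 1}"

text \<open>For \<open>\<beta> > 1\<close> the factor \<open>\<beta> / (1 - \<beta>)\<close> is negative, so a lower bound on \<open>K\<^sub>\<beta>(X|W)\<close> is an upper
  bound on \<open>H\<^sub>\<beta>(X|W)\<close>, and a minimum of \<open>K\<^sub>\<beta>(Y|W)\<close> is a maximum of \<open>H\<^sub>\<beta>(Y|W)\<close>. The version with \<open>h \<le> H\<^sub>\<beta>(X|W)\<close>
  and a minimum of \<open>H\<^sub>\<beta>(Y|W)\<close> fails, e.g. for \<open>\<beta> = 2\<close>, \<open>\<delta> = 1/4\<close>, \<open>q = 1/2\<close>.\<close>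

definition H_values :: "real \<Rightarrow> real \<Rightarrow> real \<Rightarrow> real \<Rightarrow> real set" where
  "H_values \<beta> \<delta> q h =
     {arimoto_entropy \<beta> (law_WY P) | P.
        P \<in> markov_extensions (bsc_joint q \<delta>) \<and> arimoto_entropy \<beta> (law_WX P) \<le> h}"

lemma bernoulli_K_eq_lnorm_pmf:
  assumes "0 \<le> p" "p \<le> 1"
  shows "bernoulli_K \<beta> p = lnorm_pmf \<beta> (bernoulli_pmf p)"
  using assms by (simp add: bernoulli_K_def lnorm_pmf_def UNIV_bool add.commute)

lemma lnorm_pmf_pos: "0 < lnorm_pmf \<beta> p"
proof -
  obtain x where "x \<in> set_pmf p"
    using set_pmf_not_empty[of p] by blast
  then have "0 < (\<Sum>x\<in>UNIV. pmf p x powr \<beta>)"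
    by (intro sum_pos2[of _ x]) (auto simp: set_pmf_iff)
  then show ?thesis
    by (simp add: lnorm_pmf_def)
qed

lemma lnorm_pmf_le:
  assumes "0 < \<beta>"
  shows "lnorm_pmf \<beta> (p :: 'a::finite pmf) \<le> real CARD('a) powr (1 / \<beta>)"
proof -
  have "(\<Sum>x\<in>UNIV. pmf p x powr \<beta>) \<le> (\<Sum>x\<in>(UNIV :: 'a set). 1)"
    using assms by (intro sum_mono) (simp add: powr_le1 pmf_le_1)
  then show ?thesis
    using assms by (auto simp: lnorm_pmf_def intro!: powr_mono2 sum_nonneg)
qed

lemma arimoto_K_pos:
  fixes P :: "('w \<times> 'a::finite) pmf"
  assumes "0 < \<beta>"
  shows "0 < arimoto_K \<beta> P"
proof -
  let ?M = "map_pmf fst P"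
  let ?f = "\<lambda>w. lnorm_pmf \<beta> (map_pmf snd (cond_pmf P {(w', x). w' = w}))"
  have int: "integrable (measure_pmf ?M) ?f"
    by (intro measure_pmf.integrable_const_bound[where B = "real CARD('a) powr (1 / \<beta>)"])
       (simp_all add: abs_of_pos lnorm_pmf_pos lnorm_pmf_le[OF assms])
  have "integral\<^sup>L (measure_pmf ?M) ?f \<noteq> 0"
  proof
    assume "integral\<^sup>L (measure_pmf ?M) ?f = 0"
    then have "AE w in measure_pmf ?M. ?f w = 0"
      using integral_nonneg_eq_0_iff_AE[OF int] by (simp add: lnorm_pmf_pos less_imp_le)
    then show False
      using set_pmf_not_empty[of ?M] lnorm_pmf_pos
      unfolding AE_measure_pmf_iff by (metis all_not_in_conv less_irrefl)
  qed
  moreover have "0 \<le> integral\<^sup>L (measure_pmf ?M) ?f"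
    by (rule Bochner_Integration.integral_nonneg) (simp add: lnorm_pmf_pos less_imp_le)
  ultimately show ?thesis
    by (simp add: arimoto_K_def)
qed

lemma arimoto_K_eq_exp:
  assumes "0 < \<beta>" "\<beta> \<noteq> 1"
  shows "arimoto_K \<beta> P = exp ((1 - \<beta>) / \<beta> * arimoto_entropy \<beta> P)"
  using assms arimoto_K_pos[of \<beta> P] by (simp add: arimoto_entropy_def)

end

theory Submission
  imports Defs
begin

text \<open>
  Write \<open>p = (1 - s) / 2\<close> and let \<open>g s = \<parallel>(1 + s, 1 - s)\<parallel>\<^sub>\<beta>\<close>, so that \<open>K\<^sub>\<beta>(p) = g \<bar>s\<bar> / 2\<close> and the channel
  acts by \<open>s \<mapsto> (1 - 2\<delta>) s\<close>. With \<open>c = \<bar>1 - 2\<delta>\<bar>\<close> the curve \<open>(g s, g (c s))\<close> is the graph of an increasing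
  convex function: its slope is \<open>c g'(c s) / g'(s)\<close>, which increases in \<open>s\<close> because
    \<open>s g''(s) / g'(s) = 4 (\<beta> - 1) (1 - s\<^sup>2)\<^bsup>\<beta>-2\<^esup> \<cdot> s / D(s)\<close>,
  with \<open>D(s) = ((1 + s)\<^bsup>\<beta>\<^esup> + (1 - s)\<^bsup>\<beta>\<^esup>) ((1 + s)\<^bsup>\<beta>-1\<^esup> - (1 - s)\<^bsup>\<beta>-1\<^esup>)\<close>, decreases. Jensen's inequality,
  in the form of a supporting line at \<open>K\<^sub>\<beta>(p)\<close>, then bounds \<open>K\<^sub>\<beta>(Y|W)\<close> below. Equality is attained by a
  binary \<open>W\<close> for which \<open>X\<close> is Bernoulli with parameter \<open>p\<close> or \<open>1 - p\<close>, since these have the same \<open>K\<^sub>\<beta>\<close>.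
\<close>

section \<open>Convexity of the binary norm along the channel\<close>

definition norm2 :: "real \<Rightarrow> real \<Rightarrow> real" where
  "norm2 \<beta> s = ((1 + s) powr \<beta> + (1 - s) powr \<beta>) powr (1 / \<beta>)"

definition norm2' :: "real \<Rightarrow> real \<Rightarrow> real" where
  "norm2' \<beta> s = ((1 + s) powr \<beta> + (1 - s) powr \<beta>) powr (1 / \<beta> - 1) *
     ((1 + s) powr (\<beta> - 1) - (1 - s) powr (\<beta> - 1))"

lemma powr_sum_pos: "- 1 < s \<Longrightarrow> 0 < (1 + s) powr \<beta> + (1 - s) powr \<beta>" for s :: real
  by (intro add_pos_nonneg) auto

lemma powr_diff_pos:
  fixes s a :: real
  assumes "0 < s" "s \<le> 1" "0 < a"
  shows "0 < (1 + s) powr a - (1 - s) powr a"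
  using powr_less_mono2[of a "1 - s" "1 + s"] assms by simp

lemma norm2'_pos: "0 < s \<Longrightarrow> s \<le> 1 \<Longrightarrow> 1 < \<beta> \<Longrightarrow> 0 < norm2' \<beta> s"
  using powr_sum_pos[of s \<beta>] powr_diff_pos[of s "\<beta> - 1"] by (simp add: norm2'_def)

lemma norm2'_0 [simp]: "norm2' \<beta> 0 = 0"
  by (simp add: norm2'_def)

lemma norm2'_nonneg: "0 \<le> s \<Longrightarrow> s \<le> 1 \<Longrightarrow> 1 < \<beta> \<Longrightarrow> 0 \<le> norm2' \<beta> s"
  using norm2'_pos[of s \<beta>] by (cases "s = 0") auto

lemma has_real_derivative_powr_sum:
  fixes s n :: real
  assumes "- 1 < s" "s < 1"
  shows "((\<lambda>s. (1 + s) powr n + (1 - s) powr n) has_real_derivative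
    n * ((1 + s) powr (n - 1) - (1 - s) powr (n - 1))) (at s)"
  using assms by (auto intro!: derivative_eq_intros simp: algebra_simps)

lemma has_real_derivative_powr_diff:
  fixes s n :: real
  assumes "- 1 < s" "s < 1"
  shows "((\<lambda>s. (1 + s) powr n - (1 - s) powr n) has_real_derivative
    n * ((1 + s) powr (n - 1) + (1 - s) powr (n - 1))) (at s)"
  using assms by (auto intro!: derivative_eq_intros simp: algebra_simps)

lemma has_real_derivative_norm2:
  assumes "- 1 < s" "s < 1" "\<beta> \<noteq> 0"
  shows "(norm2 \<beta> has_real_derivative norm2' \<beta> s) (at s)"
proof -
  have "0 < (1 + s) powr \<beta> + (1 - s) powr \<beta>"
    using assms by (intro powr_sum_pos)
  from DERIV_chain2[OF has_real_derivative_powr[OF this, of "1 / \<beta>"]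
      has_real_derivative_powr_sum[OF assms(1,2), of \<beta>]]
  show ?thesis
    unfolding norm2_def[abs_def] norm2'_def using assms(3) by (simp add: mult_ac)
qed

lemma continuous_on_norm2: "0 < \<beta> \<Longrightarrow> continuous_on {0..1} (norm2 \<beta>)"
  unfolding norm2_def
  by (intro continuous_intros continuous_on_powr') (auto intro: add_nonneg_nonneg)

text \<open>The formula for the derivative extends continuously to the endpoint 1, so monotonicity
  shown on the open interval carries over to the closed one. The outer exponent
  \<open>1 / \<beta> - 1\<close> is negative, hence the need for a nonzero base.\<close>

lemma continuous_on_norm2':
  assumes "1 < \<beta>"
  shows "continuous_on {0..1} (norm2' \<beta>)"
proof -
  have ne: "(1 + s) powr \<beta> + (1 - s) powr \<beta> \<noteq> 0" if "s \<in> {0..1}" for s :: real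
    using powr_sum_pos[of s \<beta>] that by auto
  have pow: "continuous_on {0..1} (\<lambda>s::real. (1 + s) powr a)"
      "continuous_on {0..1} (\<lambda>s::real. (1 - s) powr a)"
    if "0 < a" for a
    using that by (intro continuous_on_powr' continuous_intros; simp)+
  have "continuous_on {0..1} (\<lambda>s. ((1 + s) powr \<beta> + (1 - s) powr \<beta>) powr (1 / \<beta> - 1))"
    using assms by (intro continuous_on_powr continuous_on_add continuous_on_const pow ballI ne) auto
  moreover have "continuous_on {0..1} (\<lambda>s::real. (1 + s) powr (\<beta> - 1) - (1 - s) powr (\<beta> - 1))"
    using assms by (intro continuous_on_diff pow) auto
  ultimately show ?thesis
    unfolding norm2'_def[abs_def] by (rule continuous_on_mult)
qed

lemma norm2_mono:
  assumes "0 \<le> s" "s \<le> t" "t \<le> 1" "1 < \<beta>"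
  shows "norm2 \<beta> s \<le> norm2 \<beta> t"
proof (rule DERIV_nonneg_imp_increasing_open[OF \<open>s \<le> t\<close>])
  show "continuous_on {s..t} (norm2 \<beta>)"
    using assms by (intro continuous_on_subset[OF continuous_on_norm2]) auto
  show "\<exists>y. (norm2 \<beta> has_real_derivative y) (at u) \<and> 0 \<le> y" if "s < u" "u < t" for u
    using that assms by (intro exI[of _ "norm2' \<beta> u"] conjI has_real_derivative_norm2 norm2'_nonneg) auto
qed

section \<open>Logarithmic derivative of the slope of the binary norm\<close>

definition log_curv :: "real \<Rightarrow> real \<Rightarrow> real" where
  "log_curv \<beta> s = 4 * (\<beta> - 1) * (1 - s\<^sup>2) powr (\<beta> - 2) /
     (((1 + s) powr \<beta> + (1 - s) powr \<beta>) * ((1 + s) powr (\<beta> - 1) - (1 - s) powr (\<beta> - 1)))"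

text \<open>Taking logarithms splits \<open>norm2'\<close> into
  \<open>(1 / \<beta> - 1) * ln N + ln H\<close>, with N the sum of powers and H the difference of
  powers. Each summand is differentiated separately, and the two fractions combine because of the
  identity \<open>(a + b) * N - H^2 = 4 * a * b\<close>.\<close>

lemma has_real_derivative_ln_norm2':
  assumes "0 < s" "s < 1" "1 < \<beta>"
  shows "((\<lambda>s. ln (norm2' \<beta> s)) has_real_derivative log_curv \<beta> s) (at s)"
proof -
  \<comment> \<open>With the powers of exponent \<open>\<beta> - 2\<close> factored out, every other
    power is a polynomial in s times \<open>a\<close> or \<open>b\<close>, which reduces the final
    comparison to polynomial algebra.\<close>
  define a where "a = (1 + s) powr (\<beta> - 2)"
  define b where "b = (1 - s) powr (\<beta> - 2)"
  have a: "(1 + s) powr (\<beta> - 1) = a * (1 + s)" "(1 + s) powr \<beta> = a * (1 + s)\<^sup>2"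
    using assms powr_add[of "1 + s" "\<beta> - 2" 1] powr_add[of "1 + s" "\<beta> - 2" 2]
    by (simp_all add: a_def flip: powr_numeral)
  have b: "(1 - s) powr (\<beta> - 1) = b * (1 - s)" "(1 - s) powr \<beta> = b * (1 - s)\<^sup>2"
    using assms powr_add[of "1 - s" "\<beta> - 2" 1] powr_add[of "1 - s" "\<beta> - 2" 2]
    by (simp_all add: b_def flip: powr_numeral)
  have ab: "(1 - s\<^sup>2) powr (\<beta> - 2) = a * b"
    using assms powr_mult[of "1 + s" "1 - s" "\<beta> - 2"] 
    by (simp add: a_def b_def power2_eq_square algebra_simps)
  let ?N = "\<lambda>s. (1 + s) powr \<beta> + (1 - s) powr \<beta>"
  let ?H = "\<lambda>s. (1 + s) powr (\<beta> - 1) - (1 - s) powr (\<beta> - 1)"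
  have pos: "0 < ?N s" "0 < ?H s"
    using powr_sum_pos[of s \<beta>] powr_diff_pos[of s "\<beta> - 1"] assms by auto
  have "((\<lambda>s. (1 / \<beta> - 1) * ln (?N s) + ln (?H s)) has_real_derivative
     (1 / \<beta> - 1) * (\<beta> * ?H s) / ?N s + (\<beta> - 1) * (a + b) / ?H s) (at s)"
  proof (rule DERIV_add)
    show "((\<lambda>s. (1 / \<beta> - 1) * ln (?N s)) has_real_derivative
        (1 / \<beta> - 1) * (\<beta> * ?H s) / ?N s) (at s)"
      using DERIV_cmult[OF DERIV_chain2[OF DERIV_ln_divide[OF pos(1)] has_real_derivative_powr_sum],
          of "1 / \<beta> - 1"]
        assms by simp
    show "((\<lambda>s. ln (?H s)) has_real_derivative (\<beta> - 1) * (a + b) / ?H s) (at s)"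
      using DERIV_chain2[OF DERIV_ln_divide[OF pos(2)] has_real_derivative_powr_diff] assms
      by (simp add: a_def b_def)
  qed
  moreover have "(1 / \<beta> - 1) * (\<beta> * ?H s) / ?N s + (\<beta> - 1) * (a + b) / ?H s = log_curv \<beta> s"
  proof -
    have "(1 / \<beta> - 1) * (\<beta> * ?H s) = (1 - \<beta>) * ?H s"
      using assms by (simp add: field_simps)
    then have "(1 / \<beta> - 1) * (\<beta> * ?H s) / ?N s + (\<beta> - 1) * (a + b) / ?H s =
        ((1 - \<beta>) * ?H s * ?H s + (\<beta> - 1) * (a + b) * ?N s) / (?N s * ?H s)"
      using pos by (subst add_frac_eq) (simp_all only: less_imp_neq[symmetric] not_False_eq_True)
    \<comment> \<open>The squares of \<open>a\<close> and \<open>b\<close> cancel; the coefficient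
      of \<open>a * b\<close> is \<open>((1 + s) + (1 - s))^2 = 4\<close>.\<close>
    moreover have "(a + b) * ?N s - (?H s)\<^sup>2 = 4 * (1 - s\<^sup>2) powr (\<beta> - 2)"
      unfolding a b ab by (simp add: power2_eq_square algebra_simps)
    then have "(1 - \<beta>) * ?H s * ?H s + (\<beta> - 1) * (a + b) * ?N s = 4 * (\<beta> - 1) * (1 - s\<^sup>2) powr (\<beta> - 2)"
      by (simp add: power2_eq_square) algebra
    ultimately show ?thesis
      by (simp only: log_curv_def)
  qed
  moreover have "\<forall>\<^sub>F s in nhds s. ln (norm2' \<beta> s) = (1 / \<beta> - 1) * ln (?N s) + ln (?H s)"
  proof -
    have "\<forall>\<^sub>F s in nhds s. s \<in> {0<..<1}"
      using assms by (intro eventually_nhds_in_open) auto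
    then show ?thesis
    proof eventually_elim
      case (elim u)
      then have "0 < ?N u" "0 < ?H u"
        using powr_sum_pos[of u \<beta>] powr_diff_pos[of u "\<beta> - 1"] assms by auto
      then show ?case
        by (simp add: norm2'_def ln_mult ln_powr)
    qed
  qed
  ultimately show ?thesis
    by (simp add: DERIV_cong_ev[OF refl])
qed

lemma convex_on_powr_diff:
  fixes n :: real
  assumes "2 \<le> n"
  shows "convex_on {0..<1} (\<lambda>s. (1 + s) powr n - (1 - s) powr n)"
proof (rule f''_ge0_imp_convex)
  fix s :: real assume s: "s \<in> {0..<1}"
  show "((\<lambda>s. (1 + s) powr n - (1 - s) powr n) has_real_derivative
      n * ((1 + s) powr (n - 1) + (1 - s) powr (n - 1))) (at s)"
    using s by (intro has_real_derivative_powr_diff) auto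
  show "((\<lambda>s. n * ((1 + s) powr (n - 1) + (1 - s) powr (n - 1))) has_real_derivative
      n * (n - 1) * ((1 + s) powr (n - 2) - (1 - s) powr (n - 2))) (at s)"
    using DERIV_cmult[OF has_real_derivative_powr_sum[of s "n - 1"], of n] s by (simp add: mult.assoc)
  show "0 \<le> n * (n - 1) * ((1 + s) powr (n - 2) - (1 - s) powr (n - 2))"
    using s assms by (intro mult_nonneg_nonneg) (auto intro!: powr_mono2)
qed simp

text \<open>This is monotonicity of \<open>D u / u\<close>, phrased without division; D is the
  denominator of \<open>log_curv\<close>. The bound on \<beta> makes the exponent
  \<open>2 * \<beta> - 1\<close> at least 2, as \<open>convex_on_powr_diff\<close> requires.\<close>

lemma powr_sum_diff_product_scale:
  fixes s c \<beta> :: real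
  assumes s: "0 < s" "s < 1" and c: "0 \<le> c" "c \<le> 1" and \<beta>: "3 / 2 \<le> \<beta>"
  defines "D \<equiv> \<lambda>s. ((1 + s) powr \<beta> + (1 - s) powr \<beta>) * ((1 + s) powr (\<beta> - 1) - (1 - s) powr (\<beta> - 1))"
  shows "D (c * s) \<le> c * D s"
proof -
  let ?E = "\<lambda>s::real. (1 + s) powr (2 * \<beta> - 1) - (1 - s) powr (2 * \<beta> - 1)"
  \<comment> \<open>The sign of the mixed terms makes \<open>D\<close> the difference of a convex function and \<open>u\<close> times a
    decreasing one; the factor \<open>(1 + u) powr (\<beta> - 1) - (1 - u) powr (\<beta> - 1)\<close> alone is concave for \<open>\<beta> < 3\<close>.\<close>
  have D: "D u = ?E u - 2 * u * (1 - u\<^sup>2) powr (\<beta> - 1)" if "0 \<le> u" "u < 1" for u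
  proof -
    have "(1 - u\<^sup>2) powr (\<beta> - 1) = (1 + u) powr (\<beta> - 1) * (1 - u) powr (\<beta> - 1)"
      using powr_mult[of "1 + u" "1 - u" "\<beta> - 1"] that
      by (simp add: power2_eq_square algebra_simps)
    moreover have "(1 + u) powr \<beta> = (1 + u) powr (\<beta> - 1) * (1 + u)"
      "(1 - u) powr \<beta> = (1 - u) powr (\<beta> - 1) * (1 - u)"
      using that powr_add[of "1 + u" "\<beta> - 1" 1] powr_add[of "1 - u" "\<beta> - 1" 1] by simp_all
    moreover have "(1 + u) powr (2 * \<beta> - 1) = (1 + u) powr (\<beta> - 1) * (1 + u) powr (\<beta> - 1) * (1 + u)"
      "(1 - u) powr (2 * \<beta> - 1) = (1 - u) powr (\<beta> - 1) * (1 - u) powr (\<beta> - 1) * (1 - u)"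
      using that powr_add[of "1 + u" "2 * \<beta> - 2" 1] powr_add[of "1 - u" "2 * \<beta> - 2" 1]
      by (simp_all add: flip: powr_add)
    ultimately show ?thesis
      unfolding D_def by (simp only:) (simp add: algebra_simps)
  qed
  have cs: "0 \<le> c * s" "c * s \<le> s"
    using s c by (auto simp: mult_le_cancel_right1)
  \<comment> \<open>A convex function that vanishes at 0 lies below its chord from 0 to s.\<close>
  have "?E (c * s) \<le> c * ?E s"
    using convex_onD[OF convex_on_powr_diff[of "2 * \<beta> - 1"], of c 0 s] s c \<beta> by simp
  moreover have "(1 - s\<^sup>2) powr (\<beta> - 1) \<le> (1 - (c * s)\<^sup>2) powr (\<beta> - 1)"
    using cs s \<beta> by (intro powr_mono2) (auto simp: abs_square_le_1 intro!: power_mono)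
  then have "2 * (c * s) * (1 - s\<^sup>2) powr (\<beta> - 1) \<le> 2 * (c * s) * (1 - (c * s)\<^sup>2) powr (\<beta> - 1)"
    using cs by (intro mult_left_mono) auto
  moreover have "D (c * s) = ?E (c * s) - 2 * (c * s) * (1 - (c * s)\<^sup>2) powr (\<beta> - 1)"
    "c * D s = c * ?E s - 2 * (c * s) * (1 - s\<^sup>2) powr (\<beta> - 1)"
    using D[of s] D[of "c * s"] cs s order.strict_trans1[of "c * s" s 1] by (simp_all add: right_diff_distrib)
  ultimately show ?thesis
    by linarith
qed

text \<open>The two sides are the logarithmic derivatives at s of \<open>norm2' \<beta> s\<close>
  and of \<open>norm2' \<beta> (c * s)\<close>. After multiplication by s the claim is that
  \<open>s * log_curv \<beta> s\<close> decreases: the denominator is handled by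
  \<open>powr_sum_diff_product_scale\<close>, and the numerator decreases since
  \<open>\<beta> - 2\<close> is nonnegative.\<close>

lemma log_curv_scale:
  assumes s: "0 < s" "s < 1" and c: "0 < c" "c \<le> 1" and \<beta>: "2 \<le> \<beta>"
  shows "log_curv \<beta> s \<le> c * log_curv \<beta> (c * s)"
proof -
  let ?D = "\<lambda>s. ((1 + s) powr \<beta> + (1 - s) powr \<beta>) * ((1 + s) powr (\<beta> - 1) - (1 - s) powr (\<beta> - 1))"
  have cs: "0 < c * s" "c * s \<le> s"
    using s c by (auto simp: mult_le_cancel_right1)
  have pos: "0 < ?D (c * s)"
    using powr_sum_pos[of "c * s" \<beta>] powr_diff_pos[of "c * s" "\<beta> - 1"] cs s \<beta> by auto
  have "log_curv \<beta> s = c * (4 * (\<beta> - 1) * (1 - s\<^sup>2) powr (\<beta> - 2)) / (c * ?D s)"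
    using c by (simp add: log_curv_def)
  also have "\<dots> \<le> c * (4 * (\<beta> - 1) * (1 - (c * s)\<^sup>2) powr (\<beta> - 2)) / ?D (c * s)"
    using powr_sum_diff_product_scale[OF s, of c \<beta>] c \<beta> pos cs s
    by (intro frac_le mult_left_mono powr_mono2) (auto simp: abs_square_le_1 intro!: power_mono)
  also have "\<dots> = c * log_curv \<beta> (c * s)"
    by (simp add: log_curv_def)
  finally show ?thesis .
qed

lemma norm2'_ratio_mono:
  assumes st: "0 < s" "s \<le> t" "t \<le> 1" and c: "0 \<le> c" "c \<le> 1" and \<beta>: "2 \<le> \<beta>"
  shows "norm2' \<beta> (c * s) / norm2' \<beta> s \<le> norm2' \<beta> (c * t) / norm2' \<beta> t"
proof (cases "c = 0")
  case False
  with c have c0: "0 < c" by simp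
  have cu: "0 < c * u" "c * u \<le> u" if "0 < u" for u
    using that c0 c by (auto simp: mult_le_cancel_right1)
  have pos: "0 < norm2' \<beta> u" "0 < norm2' \<beta> (c * u)" if "0 < u" "u \<le> 1" for u
    using that cu[of u] order.trans[OF cu(2)[of u], of 1] \<beta> by (auto intro!: norm2'_pos)
  let ?R = "\<lambda>u. ln (norm2' \<beta> (c * u)) - ln (norm2' \<beta> u)"
  have "?R s \<le> ?R t"
  proof (rule DERIV_nonneg_imp_increasing_open[OF \<open>s \<le> t\<close>])
    fix u assume u: "s < u" "u < t"
    then have u': "0 < u" "u < 1" "0 < c * u" "c * u < 1"
      using st cu[of u] by linarith+
    have "(?R has_real_derivative c * log_curv \<beta> (c * u) - log_curv \<beta> u) (at u)"
      using DERIV_diff[OF DERIV_chain2[OF has_real_derivative_ln_norm2' DERIV_cmult_Id[of c]]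
          has_real_derivative_ln_norm2', of u \<beta> \<beta>] \<beta> u'
      by (simp add: mult.commute)
    moreover have "0 \<le> c * log_curv \<beta> (c * u) - log_curv \<beta> u"
      using log_curv_scale[of u c \<beta>] u' c0 c \<beta> by simp
    ultimately show "\<exists>y. (?R has_real_derivative y) (at u) \<and> 0 \<le> y"
      by blast
  next
    have "{s..t} \<subseteq> {0..1}" "(*) c ` {s..t} \<subseteq> {0..1}"
      using st c mult_le_one[of c] by auto
    then have "continuous_on {s..t} (norm2' \<beta>)" "continuous_on ((*) c ` {s..t}) (norm2' \<beta>)"
      using \<beta> by (auto intro!: continuous_on_subset[OF continuous_on_norm2'])
    then have "continuous_on {s..t} (\<lambda>u. norm2' \<beta> (c * u))" "continuous_on {s..t} (norm2' \<beta>)"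
      by (auto intro: continuous_on_compose2[OF _ continuous_on_mult_left[OF continuous_on_id]])
    moreover have "norm2' \<beta> u \<noteq> 0" "norm2' \<beta> (c * u) \<noteq> 0" if "u \<in> {s..t}" for u
      using pos[of u] that st by auto
    ultimately show "continuous_on {s..t} ?R"
      by (intro continuous_intros) auto
  qed
  then have "exp (?R s) \<le> exp (?R t)" by simp
  then show ?thesis
    using pos[of s] pos[of t] st by (simp add: exp_diff)
qed simp

text \<open>The slope of the curve at t is \<open>m = c * r t\<close>. The function F, which
  measures the height over a line of this slope, has derivative
  \<open>c * norm2' \<beta> u * (r u - r t)\<close>; since r increases, F falls before t and rises
  after it, so t is a minimum.\<close>

lemma norm2_supporting_line:
  assumes c: "0 \<le> c" "c \<le> 1" and t: "0 \<le> t" "t \<le> 1" and \<beta>: "2 \<le> \<beta>"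
  obtains m where "0 \<le> m"
    "\<And>s. 0 \<le> s \<Longrightarrow> s \<le> 1 \<Longrightarrow> norm2 \<beta> (c * t) + m * (norm2 \<beta> s - norm2 \<beta> t) \<le> norm2 \<beta> (c * s)"
proof (cases "t = 0")
  \<comment> \<open>At t = 0 the quotient \<open>r t\<close> would be 0 / 0. The horizontal line
    works instead, because \<open>norm2 \<beta> 0\<close> is the least value on the
    interval.\<close>
  case True
  then show ?thesis
    using that[of 0] norm2_mono[of 0 _ \<beta>] c \<beta> by (auto simp: mult_le_one)
next
  case False
  with t have t0: "0 < t" by simp
  define r where "r = (\<lambda>s. norm2' \<beta> (c * s) / norm2' \<beta> s)"
  define m where "m = c * r t"
  define F where "F = (\<lambda>s. norm2 \<beta> (c * s) - m * norm2 \<beta> s)"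
  have cu: "0 \<le> c * u" "c * u \<le> u" if "0 \<le> u" for u
    using that c by (auto simp: mult_le_cancel_right1 mult_left_le_one_le)
  have "c * u < 1" if "0 \<le> u" "u < 1" for u
    using cu[of u] that by linarith
  note cu = cu this
  have deriv: "(F has_real_derivative c * norm2' \<beta> u * (r u - r t)) (at u)" if "0 < u" "u < 1" for u
  proof -
    have "(F has_real_derivative norm2' \<beta> (c * u) * c - m * norm2' \<beta> u) (at u)"
      unfolding F_def using that cu[of u] \<beta>
      by (auto intro!: derivative_eq_intros DERIV_chain2[OF has_real_derivative_norm2]
          has_real_derivative_norm2)
    moreover have "norm2' \<beta> (c * u) * c - m * norm2' \<beta> u = c * norm2' \<beta> u * (r u - r t)"
      using norm2'_pos[of u \<beta>] that \<beta> by (simp add: m_def r_def right_diff_distrib)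
    ultimately show ?thesis
      by simp
  qed
  have "continuous_on {0..1} (\<lambda>s. norm2 \<beta> (c * s))"
    using \<beta> cu by (intro continuous_on_compose2[OF continuous_on_norm2] continuous_intros) force+
  then have cont: "continuous_on {0..1} F"
    unfolding F_def using \<beta> by (intro continuous_intros continuous_on_norm2) auto
  have "F t \<le> F s" if s: "0 \<le> s" "s \<le> 1" for s
  proof (cases "t \<le> s")
    case True
    then show ?thesis
    proof (rule DERIV_nonneg_imp_increasing_open)
      fix u assume u: "t < u" "u < s"
      then have "r t \<le> r u"
        unfolding r_def using t0 s c \<beta> by (intro norm2'_ratio_mono) auto
      then have "0 \<le> c * norm2' \<beta> u * (r u - r t)"
        using norm2'_nonneg[of u \<beta>] u t s c \<beta> by auto
      then show "\<exists>y. (F has_real_derivative y) (at u) \<and> 0 \<le> y"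
        using deriv[of u] u t s by auto
    qed (use cont t s in \<open>auto intro: continuous_on_subset\<close>)
  next
    case False
    then have "s \<le> t" by simp
    then show ?thesis
    proof (rule DERIV_nonpos_imp_decreasing_open)
      fix u assume u: "s < u" "u < t"
      then have "r u \<le> r t"
        unfolding r_def using t s c \<beta> by (intro norm2'_ratio_mono) auto
      then have "c * norm2' \<beta> u * (r u - r t) \<le> 0"
        using norm2'_nonneg[of u \<beta>] u t s c \<beta> by (intro mult_nonneg_nonpos) auto
      then show "\<exists>y. (F has_real_derivative y) (at u) \<and> y \<le> 0"
        using deriv[of u] u t s by auto
    qed (use cont t s in \<open>auto intro: continuous_on_subset\<close>)
  qed
  moreover have "0 \<le> m"
    unfolding m_def r_def using cu[of t] t c \<beta>
    by (intro mult_nonneg_nonneg divide_nonneg_nonneg norm2'_nonneg) auto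
  moreover have "norm2 \<beta> (c * t) + m * (norm2 \<beta> s - norm2 \<beta> t) \<le> norm2 \<beta> (c * s)"
    if "F t \<le> F s" for s
    using that by (simp add: F_def algebra_simps)
  ultimately show ?thesis
    using that by blast
qed

section \<open>From the norm back to Bernoulli parameters\<close>

lemma bernoulli_K_norm2: "bernoulli_K \<beta> p = norm2 \<beta> \<bar>1 - 2 * p\<bar> / 2" if "0 < \<beta>" "0 \<le> p" "p \<le> 1"
proof -
  have *: "bernoulli_K \<beta> ((1 - s) / 2) = norm2 \<beta> s / 2" if "\<bar>s\<bar> \<le> 1" for s
  proof -
    have "bernoulli_K \<beta> ((1 - s) / 2) = (((1 - s) / 2) powr \<beta> + ((1 + s) / 2) powr \<beta>) powr (1 / \<beta>)"
    proof -
      have "1 - (1 - s) / 2 = (1 + s) / 2"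
        by (simp add: field_simps)
      then show ?thesis
        by (simp only: bernoulli_K_def)
    qed
    also have "\<dots> = (((1 + s) powr \<beta> + (1 - s) powr \<beta>) / 2 powr \<beta>) powr (1 / \<beta>)"
      using that by (simp add: powr_divide add_divide_distrib[of "_ powr _"] add.commute)
    also have "\<dots> = norm2 \<beta> s / 2"
      using \<open>0 < \<beta>\<close> by (simp add: powr_divide norm2_def powr_powr)
    finally show ?thesis .
  qed
  \<comment> \<open>The norm is even in s; the absolute value puts the argument into
    \<open>{0..1}\<close>, where continuity and monotonicity are available.\<close>
  have "norm2 \<beta> (1 - 2 * p) = norm2 \<beta> \<bar>1 - 2 * p\<bar>"
    by (simp add: norm2_def abs_if add.commute)
  then show ?thesis
    using *[of "1 - 2 * p"] that by simp
qed

lemma bin_conv_bounds: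
  assumes "0 \<le> a" "a \<le> 1" "0 \<le> b" "b \<le> 1"
  shows "0 \<le> a \<star> b" "a \<star> b \<le> 1"
proof -
  have "0 \<le> (1 - a) * b" "0 \<le> (1 - b) * a" "0 \<le> (1 - a) * (1 - b)" "0 \<le> a * b"
    using assms by simp_all
  then show "0 \<le> a \<star> b" "a \<star> b \<le> 1"
    unfolding bin_conv_def by (simp_all add: algebra_simps)
qed

lemma bernoulli_K_bin_conv:
  assumes "0 < \<beta>" "0 \<le> p" "p \<le> 1" "0 \<le> \<delta>" "\<delta> \<le> 1"
  shows "bernoulli_K \<beta> (p \<star> \<delta>) = norm2 \<beta> (\<bar>1 - 2 * \<delta>\<bar> * \<bar>1 - 2 * p\<bar>) / 2"
proof -
  have "1 - 2 * (p \<star> \<delta>) = (1 - 2 * \<delta>) * (1 - 2 * p)"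
    by (simp add: bin_conv_def algebra_simps)
  then show ?thesis
    using bernoulli_K_norm2[of \<beta> "p \<star> \<delta>"] bin_conv_bounds[of p \<delta>] assms by (simp add: abs_mult)
qed

lemma bernoulli_K_0 [simp]: "bernoulli_K \<beta> 0 = 1"
  by (simp add: bernoulli_K_def)

lemma bernoulli_K_compl: "bernoulli_K \<beta> (1 - p) = bernoulli_K \<beta> p"
  by (simp add: bernoulli_K_def add.commute)

lemma bin_conv_compl: "(1 - p) \<star> \<delta> = 1 - p \<star> \<delta>"
  by (simp add: bin_conv_def algebra_simps)

lemma bernoulli_K_antimono:
  assumes "1 < \<beta>" "0 \<le> p" "p \<le> q" "q \<le> 1 / 2"
  shows "bernoulli_K \<beta> q \<le> bernoulli_K \<beta> p"
  using norm2_mono[of "1 - 2 * q" "1 - 2 * p" \<beta>] assms by (simp add: bernoulli_K_norm2)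

text \<open>The intermediate value theorem turns the admissible range of x into a parametrisation by
  p.\<close>

lemma bernoulli_K_image:
  assumes "1 < \<beta>" "0 \<le> q" "q \<le> 1 / 2"
  shows "bernoulli_K \<beta> ` {0..q} = {bernoulli_K \<beta> q..1}"
proof (intro equalityI subsetI)
  fix x assume x: "x \<in> {bernoulli_K \<beta> q..1}"
  have "continuous_on {0..q} (\<lambda>p. norm2 \<beta> (1 - 2 * p) / 2)"
    using assms by (intro continuous_intros continuous_on_compose2[OF continuous_on_norm2]) auto
  then have "continuous_on {0..q} (bernoulli_K \<beta>)"
    using assms by (simp add: bernoulli_K_norm2 cong: continuous_on_cong_simp)
  then show "x \<in> bernoulli_K \<beta> ` {0..q}"
    using IVT2'[of "bernoulli_K \<beta>" q x 0] x assms by auto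
next
  fix x assume "x \<in> bernoulli_K \<beta> ` {0..q}"
  then show "x \<in> {bernoulli_K \<beta> q..1}"
    using bernoulli_K_antimono[of \<beta> _ q] bernoulli_K_antimono[of \<beta> 0] assms by auto
qed

text \<open>Halving both coordinates of the curve leaves slopes unchanged, so the slope from
  \<open>norm2_supporting_line\<close> is reused. All of [0,1] is covered because the conditional
  laws of X may lie on either side of 1/2.\<close>

lemma bernoulli_K_supporting_line:
  assumes "2 \<le> \<beta>" "0 \<le> \<delta>" "\<delta> \<le> 1" "0 \<le> p" "p \<le> 1"
  obtains m where "0 \<le> m"
    "\<And>a. 0 \<le> a \<Longrightarrow> a \<le> 1 \<Longrightarrow>
      bernoulli_K \<beta> (p \<star> \<delta>) + m * (bernoulli_K \<beta> a - bernoulli_K \<beta> p) \<le> bernoulli_K \<beta> (a \<star> \<delta>)"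
proof -
  obtain m where m: "0 \<le> m" "\<And>s. 0 \<le> s \<Longrightarrow> s \<le> 1 \<Longrightarrow>
      norm2 \<beta> (\<bar>1 - 2 * \<delta>\<bar> * \<bar>1 - 2 * p\<bar>) + m * (norm2 \<beta> s - norm2 \<beta> \<bar>1 - 2 * p\<bar>)
        \<le> norm2 \<beta> (\<bar>1 - 2 * \<delta>\<bar> * s)"
    using norm2_supporting_line[of "\<bar>1 - 2 * \<delta>\<bar>" "\<bar>1 - 2 * p\<bar>" \<beta>] assms by (auto simp: abs_le_iff)
  show ?thesis
  proof
    show "bernoulli_K \<beta> (p \<star> \<delta>) + m * (bernoulli_K \<beta> a - bernoulli_K \<beta> p) \<le> bernoulli_K \<beta> (a \<star> \<delta>)"
      if "0 \<le> a" "a \<le> 1" for a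
    proof -
      have "norm2 \<beta> (\<bar>1 - 2 * \<delta>\<bar> * \<bar>1 - 2 * p\<bar>) / 2
          + m * (norm2 \<beta> \<bar>1 - 2 * a\<bar> / 2 - norm2 \<beta> \<bar>1 - 2 * p\<bar> / 2)
          \<le> norm2 \<beta> (\<bar>1 - 2 * \<delta>\<bar> * \<bar>1 - 2 * a\<bar>) / 2"
        using m(2)[of "\<bar>1 - 2 * a\<bar>"] that by (simp add: abs_le_iff field_simps)
      then show ?thesis
        using that assms by (simp add: bernoulli_K_norm2 bernoulli_K_bin_conv)
    qed
  qed (rule m(1))
qed

section \<open>Joint laws of Markov chains\<close>

lemma map_fst_bind_Pair: "map_pmf fst (bind_pmf M (\<lambda>w. map_pmf (Pair w) (N w))) = M"
  by (simp add: map_bind_pmf pmf.map_comp o_def bind_return_pmf' flip: map_pmf_def)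

lemma pmf_bind_Pair:
  "pmf (bind_pmf M (\<lambda>w. map_pmf (Pair w) (N w))) (w, x) = pmf M w * pmf (N w) x"
proof -
  have "pmf (map_pmf (Pair u) (N u)) (w, x) = pmf (N w) x * indicator {w} u" for u
    using pmf_map_inj'[of "Pair u" "N u" x] by (cases "u = w") (auto simp: inj_def intro: pmf_map_outside)
  then show ?thesis
    by (simp add: pmf_bind measure_pmf_single mult.commute)
qed

lemma cond_pmf_bind_Pair:
  assumes "w \<in> set_pmf M"
  shows "cond_pmf (bind_pmf M (\<lambda>w. map_pmf (Pair w) (N w))) {(w', x). w' = w} = map_pmf (Pair w) (N w)"
proof (rule pmf_eqI)
  fix z :: "'a \<times> 'b"
  let ?P = "bind_pmf M (\<lambda>w. map_pmf (Pair w) (N w))"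
  have "measure ?P {(w', x). w' = w} = measure (map_pmf fst ?P) {w}"
    by (auto simp: vimage_def intro!: arg_cong[where f = "measure ?P"])
  then have meas: "measure ?P {(w', x). w' = w} = pmf M w"
    unfolding map_fst_bind_Pair by (simp add: measure_pmf_single)
  have "set_pmf ?P \<inter> {(w', x). w' = w} \<noteq> {}"
    using assms set_pmf_not_empty[of "N w"] by auto
  moreover have "pmf (map_pmf (Pair w) (N w)) (v, x) = (if v = w then pmf (N w) x else 0)" for v x
    using pmf_map_inj'[of "Pair w" "N w" x] by (auto simp: inj_def intro: pmf_map_outside)
  ultimately show "pmf (cond_pmf ?P {(w', x). w' = w}) z = pmf (map_pmf (Pair w) (N w)) z"
    using assms by (cases z) (auto simp: pmf_cond meas pmf_bind_Pair set_pmf_iff)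
qed

text \<open>Conditioning on W = w recovers \<open>N w\<close> for w in the support of M, which is
  enough for equality of the integrands almost everywhere.\<close>

lemma arimoto_K_bind_Pair:
  "arimoto_K \<beta> (bind_pmf M (\<lambda>w. map_pmf (Pair w) (N w))) = measure_pmf.expectation M (\<lambda>w. lnorm_pmf \<beta> (N w))"
  unfolding arimoto_K_def map_fst_bind_Pair
  by (rule integral_cong_AE)
     (auto simp: AE_measure_pmf_iff cond_pmf_bind_Pair pmf.map_comp o_def)

lemma map_pmf_idI: "(\<And>x. x \<in> set_pmf p \<Longrightarrow> f x = x) \<Longrightarrow> map_pmf f p = p"
  using map_pmf_cong[of p p f "\<lambda>x. x"] by (simp add: map_pmf_ident)

text \<open>Disintegration: \<open>N w\<close> is the conditional law of the second coordinate given
  that the first equals w.\<close>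

lemma pmf_eq_bind_Pair:
  fixes P :: "('a \<times> 'b) pmf"
  obtains N where "P = bind_pmf (map_pmf fst P) (\<lambda>w. map_pmf (Pair w) (N w))"
proof
  let ?C = "\<lambda>w. cond_pmf P {z. w = fst z}"
  have "bind_pmf (map_pmf fst P) ?C = P"
  proof (rule bind_cond_pmf_cancel)
    fix w and z :: "'a \<times> 'b" assume "w = fst z"
    then show "measure P {z. w = fst z} = measure (map_pmf fst P) {w. w = fst z}"
      by (auto simp: vimage_def eq_commute intro!: arg_cong[where f = "measure P"])
  qed auto
  moreover have "map_pmf (Pair w) (map_pmf snd (?C w)) = ?C w" if "w \<in> set_pmf (map_pmf fst P)" for w
  proof -
    have "set_pmf (?C w) \<subseteq> {z. w = fst z}"
      using that by (subst set_cond_pmf) auto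
    then show ?thesis
      by (auto simp: pmf.map_comp intro!: map_pmf_idI)
  qed
  ultimately show "P = bind_pmf (map_pmf fst P) (\<lambda>w. map_pmf (Pair w) (map_pmf snd (?C w)))"
    by (metis (no_types, lifting) bind_pmf_cong)
qed

text \<open>Dividing by the square of the probability of x gives the product form of the conditional
  law of (W, Y). For x of probability zero both sides vanish, so the equation may range over all x,
  and conditioning becomes arithmetic on point masses.\<close>

lemma markov_chain_iff:
  "markov_chain P \<longleftrightarrow> (\<forall>w x y. pmf P (w, x, y) * pmf (map_pmf (\<lambda>(w, x, y). x) P) x =
     pmf (law_WX P) (w, x) * pmf (map_pmf snd P) (x, y))"
proof -
  let ?X = "map_pmf (\<lambda>(w, x, y). x) P"
  let ?S = "\<lambda>x. {(w, x', y). x' = x}"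
  have X: "pmf ?X x = measure P (?S x)" for x
    by (auto simp: pmf_map vimage_def intro!: arg_cong[where f = "measure P"])
  have "(let C = cond_pmf P (?S x) in map_pmf (\<lambda>(w, x, y). (w, y)) C =
           pair_pmf (map_pmf (\<lambda>(w, x, y). w) C) (map_pmf (\<lambda>(w, x, y). y) C)) \<longleftrightarrow>
        (\<forall>w y. pmf P (w, x, y) * pmf ?X x = pmf (law_WX P) (w, x) * pmf (map_pmf snd P) (x, y))"
    if x: "x \<in> set_pmf ?X" for x
  proof -
    have ne: "set_pmf P \<inter> ?S x \<noteq> {}"
      using x by auto
    define C where "C = cond_pmf P (?S x)"
    have pos: "0 < measure P (?S x)"
      using x X pmf_positive by metis
    have C: "measure C A = measure P (?S x \<inter> A) / measure P (?S x)" for A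
      unfolding C_def cond_pmf.rep_eq[OF ne] using pos
      by (subst measure_uniform_measure) (auto simp: measure_pmf.emeasure_eq_measure)
    have eqs: "?S x \<inter> (\<lambda>(w, x, y). (w, y)) -` {(w, y)} = {(w, x, y)}"
      "?S x \<inter> (\<lambda>(w, x, y). w) -` {w} = (\<lambda>(w, x, y). (w, x)) -` {(w, x)}"
      "?S x \<inter> (\<lambda>(w, x, y). y) -` {y} = snd -` {(x, y)}" for w y
      by auto
    have WY: "pmf (map_pmf (\<lambda>(w, x, y). (w, y)) C) (w, y) = pmf P (w, x, y) / pmf ?X x" for w y
      unfolding X by (simp add: pmf_map C eqs measure_pmf_single)
    have W: "pmf (map_pmf (\<lambda>(w, x, y). w) C) w = pmf (law_WX P) (w, x) / pmf ?X x" for w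
      unfolding X by (simp add: law_WX_def pmf_map C eqs)
    have Y: "pmf (map_pmf (\<lambda>(w, x, y). y) C) y = pmf (map_pmf snd P) (x, y) / pmf ?X x" for y
      unfolding X by (simp add: pmf_map C eqs)
    show ?thesis
      unfolding C_def[symmetric] Let_def pmf_eq_iff split_paired_All WY W Y pmf_pair
      using pos by (simp add: X field_simps)
  qed
  moreover have "pmf P (w, x, y) * pmf ?X x = pmf (law_WX P) (w, x) * pmf (map_pmf snd P) (x, y)"
    if "x \<notin> set_pmf ?X" for w x y
  proof -
    have "(w, x) \<notin> set_pmf (law_WX P)" "(w, x, y) \<notin> set_pmf P"
      using that by (force simp: law_WX_def)+
    then show ?thesis
      by (simp add: set_pmf_iff)
  qed
  ultimately show ?thesis
    unfolding markov_chain_def by metis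
qed

section \<open>Markov chains as compositions of kernels\<close>

definition chain_law :: "'w pmf \<Rightarrow> ('w \<Rightarrow> 'a pmf) \<Rightarrow> ('a \<Rightarrow> 'b pmf) \<Rightarrow> ('w \<times> 'a \<times> 'b) pmf" where
  "chain_law M N \<kappa> = bind_pmf M (\<lambda>w. map_pmf (Pair w) (bind_pmf (N w) (\<lambda>x. map_pmf (Pair x) (\<kappa> x))))"

lemma pmf_chain_law: "pmf (chain_law M N \<kappa>) (w, x, y) = pmf M w * pmf (N w) x * pmf (\<kappa> x) y"
  by (simp add: chain_law_def pmf_bind_Pair)

lemma law_WX_chain_law:
  fixes M :: "'w pmf" and N :: "'w \<Rightarrow> 'a pmf" and \<kappa> :: "'a \<Rightarrow> 'b pmf"
  shows "law_WX (chain_law M N \<kappa>) = bind_pmf M (\<lambda>w. map_pmf (Pair w) (N w))"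
proof -
  have "map_pmf (\<lambda>(w, x, y). (w, x)) (map_pmf (Pair w) Q) = map_pmf (Pair w) (map_pmf fst Q)"
    for w :: 'w and Q :: "('a \<times> 'b) pmf"
    by (simp add: pmf.map_comp o_def case_prod_beta)
  then show ?thesis
    by (simp add: law_WX_def chain_law_def map_bind_pmf[of "\<lambda>(w, x, y). (w, x)"] map_fst_bind_Pair)
qed

lemma law_WY_chain_law:
  fixes M :: "'w pmf" and N :: "'w \<Rightarrow> 'a pmf" and \<kappa> :: "'a \<Rightarrow> 'b pmf"
  shows "law_WY (chain_law M N \<kappa>) = bind_pmf M (\<lambda>w. map_pmf (Pair w) (bind_pmf (N w) \<kappa>))"
proof -
  have "map_pmf (\<lambda>(w, x, y). (w, y)) (map_pmf (Pair w) Q) = map_pmf (Pair w) (map_pmf snd Q)"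
    for w :: 'w and Q :: "('a \<times> 'b) pmf"
    by (simp add: pmf.map_comp o_def case_prod_beta)
  moreover have "map_pmf snd (bind_pmf Q (\<lambda>x. map_pmf (Pair x) (\<kappa> x))) = bind_pmf Q \<kappa>" for Q :: "'a pmf"
    by (simp add: map_bind_pmf pmf.map_comp o_def)
  ultimately show ?thesis
    by (simp add: law_WY_def chain_law_def map_bind_pmf[of "\<lambda>(w, x, y). (w, y)"])
qed

lemma map_snd_chain_law:
  "map_pmf snd (chain_law M N \<kappa>) = bind_pmf (bind_pmf M N) (\<lambda>x. map_pmf (Pair x) (\<kappa> x))"
  by (simp add: chain_law_def map_bind_pmf[of snd] pmf.map_comp o_def bind_assoc_pmf)

lemma map_X_conv: "map_pmf (\<lambda>(w, x, y). x) P = map_pmf fst (map_pmf snd P)"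
  by (simp add: pmf.map_comp o_def case_prod_beta')

lemma markov_chain_chain_law: "markov_chain (chain_law M N \<kappa>)"
  by (simp add: markov_chain_iff map_X_conv map_snd_chain_law map_fst_bind_Pair law_WX_chain_law
      pmf_bind_Pair pmf_chain_law)

text \<open>Disintegrating the law of (W, X) supplies M and N; the factorisation in
  \<open>markov_chain_iff\<close> then determines every point mass of P.\<close>

lemma markov_chain_eq_chain_law:
  assumes "markov_chain P" and snd: "map_pmf snd P = bind_pmf Q (\<lambda>x. map_pmf (Pair x) (\<kappa> x))"
  shows "\<exists>M N. P = chain_law M N \<kappa>"
proof -
  obtain M N where MN: "law_WX P = bind_pmf M (\<lambda>w. map_pmf (Pair w) (N w))"
    using pmf_eq_bind_Pair by metis
  have X: "map_pmf (\<lambda>(w, x, y). x) P = Q"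
    by (simp add: map_X_conv snd map_fst_bind_Pair)
  have "pmf P (w, x, y) = pmf (chain_law M N \<kappa>) (w, x, y)" for w x y
  \<comment> \<open>For x of probability zero the factorisation only says 0 = 0, so both point
    masses are shown to vanish directly.\<close>
  proof (cases "pmf Q x = 0")
    case True
    then have "x \<notin> set_pmf (map_pmf (\<lambda>(w, x, y). x) P)"
      by (simp only: X set_pmf_iff)
    then have "(w, x, y) \<notin> set_pmf P" "(w, x) \<notin> set_pmf (law_WX P)"
      by (force simp: law_WX_def)+
    then have "pmf P (w, x, y) = 0" "pmf (law_WX P) (w, x) = 0"
      by (simp_all add: set_pmf_iff)
    then show ?thesis
      by (simp add: MN pmf_chain_law pmf_bind_Pair)
  next
    case False
    have "pmf P (w, x, y) * pmf Q x = pmf (law_WX P) (w, x) * pmf (map_pmf snd P) (x, y)"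
      using assms(1) unfolding markov_chain_iff X by blast
    then show ?thesis
      using False by (simp add: MN snd pmf_chain_law pmf_bind_Pair)
  qed
  then have "P = chain_law M N \<kappa>"
    by (intro pmf_eqI) auto
  then show ?thesis
    by blast
qed

section \<open>Binary alphabets: both K as expectations over W\<close>

lemma lnorm_pmf_bool: "lnorm_pmf \<beta> N = bernoulli_K \<beta> (pmf N True)"
  by (simp add: lnorm_pmf_def bernoulli_K_def UNIV_bool pmf_False_conv_True add.commute)

lemma pmf_bind_bsc:
  assumes "0 \<le> \<delta>" "\<delta> \<le> 1"
  shows "pmf (bind_pmf N (bsc \<delta>)) True = pmf N True \<star> \<delta>"
proof -
  have "pmf (bind_pmf N (bsc \<delta>)) True = (\<Sum>x\<in>UNIV. pmf (bsc \<delta> x) True * pmf N x)"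
    unfolding pmf_bind by (rule integral_measure_pmf_real) auto
  then show ?thesis
    using assms by (simp add: UNIV_bool bsc_def bin_conv_def pmf_False_conv_True algebra_simps)
qed

lemma arimoto_K_law_WX:
  "arimoto_K \<beta> (law_WX (chain_law M N \<kappa>)) = measure_pmf.expectation M (\<lambda>w. bernoulli_K \<beta> (pmf (N w) True))"
  by (simp add: law_WX_chain_law arimoto_K_bind_Pair lnorm_pmf_bool)

lemma arimoto_K_law_WY:
  assumes "0 \<le> \<delta>" "\<delta> \<le> 1"
  shows "arimoto_K \<beta> (law_WY (chain_law M N (bsc \<delta>))) =
    measure_pmf.expectation M (\<lambda>w. bernoulli_K \<beta> (pmf (N w) True \<star> \<delta>))"
  using assms by (simp add: law_WY_chain_law arimoto_K_bind_Pair lnorm_pmf_bool pmf_bind_bsc)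

text \<open>W may have infinite support, so integrability is not automatic; it follows from
  boundedness.\<close>

lemma integrable_bernoulli_K:
  assumes "0 < \<beta>" "\<And>w. 0 \<le> f w" "\<And>w. f w \<le> 1"
  shows "integrable (measure_pmf M) (\<lambda>w. bernoulli_K \<beta> (f w))"
  using assms
  by (intro measure_pmf.integrable_const_bound[where B = "2 powr (1 / \<beta>)"])
     (use lnorm_pmf_le[OF assms(1), where 'a = bool] in
      \<open>simp_all add: bernoulli_K_eq_lnorm_pmf abs_of_pos lnorm_pmf_pos\<close>)

text \<open>This is Jensen's inequality: the supporting line at p is integrated over W. The slope m
  is chosen before P, and keeping the line itself rather than its value at p serves both the
  equality constraint on K and the inequality constraint on H.\<close>

lemma markov_extensions_lower_bound:
  assumes "2 \<le> \<beta>" "0 \<le> \<delta>" "\<delta> \<le> 1" "0 \<le> p" "p \<le> 1"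
  obtains m where "0 \<le> m"
    "\<And>P. P \<in> markov_extensions (bsc_joint q \<delta>) \<Longrightarrow>
      bernoulli_K \<beta> (p \<star> \<delta>) + m * (arimoto_K \<beta> (law_WX P) - bernoulli_K \<beta> p) \<le> arimoto_K \<beta> (law_WY P)"
proof -
  obtain m where m: "0 \<le> m"
    "\<And>a. 0 \<le> a \<Longrightarrow> a \<le> 1 \<Longrightarrow>
      bernoulli_K \<beta> (p \<star> \<delta>) + m * (bernoulli_K \<beta> a - bernoulli_K \<beta> p) \<le> bernoulli_K \<beta> (a \<star> \<delta>)"
    using bernoulli_K_supporting_line[OF assms] by blast
  have "bernoulli_K \<beta> (p \<star> \<delta>) + m * (arimoto_K \<beta> (law_WX P) - bernoulli_K \<beta> p) \<le> arimoto_K \<beta> (law_WY P)"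
    if P_ext: "P \<in> markov_extensions (bsc_joint q \<delta>)" for P
  proof -
    obtain M N where P: "P = chain_law M N (bsc \<delta>)"
      using P_ext markov_chain_eq_chain_law[of P "bernoulli_pmf q" "bsc \<delta>"]
      unfolding markov_extensions_def bsc_joint_def by blast
    let ?a = "\<lambda>w. pmf (N w) True"
    have int: "integrable M (\<lambda>w. bernoulli_K \<beta> (?a w))" "integrable M (\<lambda>w. bernoulli_K \<beta> (?a w \<star> \<delta>))"
      using assms by (intro integrable_bernoulli_K; simp add: pmf_le_1 bin_conv_bounds)+
    have "bernoulli_K \<beta> (p \<star> \<delta>) + m * (measure_pmf.expectation M (\<lambda>w. bernoulli_K \<beta> (?a w)) - bernoulli_K \<beta> p) =
        measure_pmf.expectation M (\<lambda>w. bernoulli_K \<beta> (p \<star> \<delta>) + m * (bernoulli_K \<beta> (?a w) - bernoulli_K \<beta> p))"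
      using int by simp
    also have "\<dots> \<le> measure_pmf.expectation M (\<lambda>w. bernoulli_K \<beta> (?a w \<star> \<delta>))"
      using int by (intro integral_mono m(2)) (auto simp: pmf_le_1)
    finally show ?thesis
      using assms by (simp add: P arimoto_K_law_WX arimoto_K_law_WY)
  qed
  with m(1) show ?thesis
    using that by blast
qed

text \<open>The weight t of the parameter \<open>1 - p\<close> solves
  \<open>(1 - t) * p + t * (1 - p) = q\<close>, which gives X the right marginal, and
  \<open>p \<le> q \<le> 1 / 2\<close> yields \<open>t \<le> 1\<close>. The channel commutes with
  the flip of p to \<open>1 - p\<close>, so both integrands are constant in w.\<close>

lemma markov_extension_attaining:
  assumes "0 \<le> \<delta>" "\<delta> \<le> 1" "0 \<le> p" "p \<le> q" "q \<le> 1 / 2"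
  obtains P where "P \<in> markov_extensions (bsc_joint q \<delta>)"
    "arimoto_K \<beta> (law_WX P) = bernoulli_K \<beta> p" "arimoto_K \<beta> (law_WY P) = bernoulli_K \<beta> (p \<star> \<delta>)"
proof
  \<comment> \<open>For \<open>p = 1 / 2\<close> also \<open>q = 1 / 2\<close>, and \<open>t = 0 / 0 = 0\<close> is a valid choice.\<close>
  define t where "t = (q - p) / (1 - 2 * p)"
  have t: "0 \<le> t" "t \<le> 1"
    using assms by (auto simp: t_def divide_le_eq_1)
  have tp: "t * (1 - 2 * p) = q - p"
    using assms by (cases "p = 1 / 2") (auto simp: t_def)
  \<comment> \<open>W is coded by 0 and 1 because \<open>markov_extensions\<close> takes W in the
    natural numbers; 0 selects p and 1 selects \<open>1 - p\<close>.\<close>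
  define M where "M = map_pmf (of_bool :: bool \<Rightarrow> nat) (bernoulli_pmf t)"
  define N where "N = (\<lambda>w::nat. bernoulli_pmf (if w = 0 then p else 1 - p))"
  have "pmf (bind_pmf M N) True = q"
  proof -
    have "pmf (bind_pmf M N) True = measure_pmf.expectation (bernoulli_pmf t) (\<lambda>b. if b then 1 - p else p)"
      unfolding pmf_bind M_def N_def using assms by (auto intro!: Bochner_Integration.integral_cong)
    also have "\<dots> = p + t * (1 - 2 * p)"
      using t by (simp add: algebra_simps)
    finally show ?thesis
      by (simp add: tp)
  qed
  then have "pmf (bind_pmf M N) x = pmf (bernoulli_pmf q) x" for x
    using assms by (cases x) (simp_all add: pmf_False_conv_True)
  then have "bind_pmf M N = bernoulli_pmf q"
    by (rule pmf_eqI)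
  then show "chain_law M N (bsc \<delta>) \<in> markov_extensions (bsc_joint q \<delta>)"
    by (simp add: markov_extensions_def map_snd_chain_law markov_chain_chain_law bsc_joint_def)
  have N: "pmf (N w) True = (if w = 0 then p else 1 - p)" for w
    using assms by (simp add: N_def)
  show "arimoto_K \<beta> (law_WX (chain_law M N (bsc \<delta>))) = bernoulli_K \<beta> p"
    by (simp add: arimoto_K_law_WX N bernoulli_K_compl if_distrib cong: if_cong)
  have "bernoulli_K \<beta> (pmf (N w) True \<star> \<delta>) = bernoulli_K \<beta> (p \<star> \<delta>)" for w
    by (simp add: N bin_conv_compl bernoulli_K_compl)
  then show "arimoto_K \<beta> (law_WY (chain_law M N (bsc \<delta>))) = bernoulli_K \<beta> (p \<star> \<delta>)"
    using assms by (simp add: arimoto_K_law_WY)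
qed

section \<open>Optimal values and the curve\<close>

lemma K_values_minimum:
  assumes "2 \<le> \<beta>" "0 \<le> \<delta>" "\<delta> \<le> 1" "0 \<le> p" "p \<le> q" "q \<le> 1 / 2"
  shows "is_minimum (bernoulli_K \<beta> (p \<star> \<delta>)) (K_values \<beta> \<delta> q (bernoulli_K \<beta> p))"
proof -
  obtain m where m: "0 \<le> m"
    "\<And>P. P \<in> markov_extensions (bsc_joint q \<delta>) \<Longrightarrow>
      bernoulli_K \<beta> (p \<star> \<delta>) + m * (arimoto_K \<beta> (law_WX P) - bernoulli_K \<beta> p) \<le> arimoto_K \<beta> (law_WY P)"
    using assms markov_extensions_lower_bound[of \<beta> \<delta> p q] by auto
  obtain P where P: "P \<in> markov_extensions (bsc_joint q \<delta>)"
    "arimoto_K \<beta> (law_WX P) = bernoulli_K \<beta> p" "arimoto_K \<beta> (law_WY P) = bernoulli_K \<beta> (p \<star> \<delta>)"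
    using assms markov_extension_attaining[of \<delta> p q \<beta>] by auto
  have "bernoulli_K \<beta> (p \<star> \<delta>) \<in> K_values \<beta> \<delta> q (bernoulli_K \<beta> p)"
    unfolding K_values_def using P by (intro CollectI exI[of _ P]) simp
  then show ?thesis
    using m(2) by (force simp: is_minimum_def K_values_def)
qed

lemma arimoto_entropy_le_iff:
  assumes "1 < \<beta>" "0 < x"
  shows "arimoto_entropy \<beta> P \<le> \<beta> / (1 - \<beta>) * ln x \<longleftrightarrow> x \<le> arimoto_K \<beta> P"
proof -
  have "\<beta> / (1 - \<beta>) < 0"
    using assms by (simp add: divide_pos_neg)
  then show ?thesis
    unfolding arimoto_entropy_def using assms arimoto_K_pos[of \<beta> P]
    by (simp only: mult_le_cancel_left_neg ln_le_cancel_iff)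
qed

lemma H_values_maximum:
  assumes "2 \<le> \<beta>" "0 \<le> \<delta>" "\<delta> \<le> 1" "0 \<le> p" "p \<le> q" "q \<le> 1 / 2"
  shows "is_maximum (\<beta> / (1 - \<beta>) * ln (bernoulli_K \<beta> (p \<star> \<delta>)))
    (H_values \<beta> \<delta> q (\<beta> / (1 - \<beta>) * ln (bernoulli_K \<beta> p)))"
proof -
  have pos: "0 < bernoulli_K \<beta> p" "0 < bernoulli_K \<beta> (p \<star> \<delta>)"
    using assms bin_conv_bounds[of p \<delta>] by (simp_all add: bernoulli_K_eq_lnorm_pmf lnorm_pmf_pos)
  obtain m where m: "0 \<le> m"
    "\<And>P. P \<in> markov_extensions (bsc_joint q \<delta>) \<Longrightarrow>
      bernoulli_K \<beta> (p \<star> \<delta>) + m * (arimoto_K \<beta> (law_WX P) - bernoulli_K \<beta> p) \<le> arimoto_K \<beta> (law_WY P)"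
    using assms markov_extensions_lower_bound[of \<beta> \<delta> p q] by auto
  obtain P where P: "P \<in> markov_extensions (bsc_joint q \<delta>)"
    "arimoto_K \<beta> (law_WX P) = bernoulli_K \<beta> p" "arimoto_K \<beta> (law_WY P) = bernoulli_K \<beta> (p \<star> \<delta>)"
    using assms markov_extension_attaining[of \<delta> p q \<beta>] by auto
  \<comment> \<open>The constraint is now only an inequality. Since m is nonnegative, the supporting
    line to the right of \<open>bernoulli_K \<beta> p\<close> stays above its value there.\<close>
  have bound: "bernoulli_K \<beta> (p \<star> \<delta>) \<le> arimoto_K \<beta> (law_WY P)"
    if "P \<in> markov_extensions (bsc_joint q \<delta>)" "bernoulli_K \<beta> p \<le> arimoto_K \<beta> (law_WX P)" for P
    using m(2)[OF that(1)] mult_nonneg_nonneg[OF m(1), of "arimoto_K \<beta> (law_WX P) - bernoulli_K \<beta> p"] that(2)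
    by simp
  have le_iff: "arimoto_entropy \<beta> (R :: (nat \<times> bool) pmf) \<le> \<beta> / (1 - \<beta>) * ln x \<longleftrightarrow> x \<le> arimoto_K \<beta> R"
    if "0 < x" for R x
    using arimoto_entropy_le_iff[of \<beta> x R] assms that by simp
  have "\<beta> / (1 - \<beta>) * ln (bernoulli_K \<beta> (p \<star> \<delta>)) = arimoto_entropy \<beta> (law_WY P)"
    by (simp only: arimoto_entropy_def P)
  then have "\<beta> / (1 - \<beta>) * ln (bernoulli_K \<beta> (p \<star> \<delta>)) \<in> H_values \<beta> \<delta> q (\<beta> / (1 - \<beta>) * ln (bernoulli_K \<beta> p))"
    unfolding H_values_def le_iff[OF pos(1)] using P by (intro CollectI exI[of _ P]) simp
  moreover have "s \<le> \<beta> / (1 - \<beta>) * ln (bernoulli_K \<beta> (p \<star> \<delta>))"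
    if s: "s \<in> H_values \<beta> \<delta> q (\<beta> / (1 - \<beta>) * ln (bernoulli_K \<beta> p))" for s
  proof -
    obtain R where R: "s = arimoto_entropy \<beta> (law_WY R)" "R \<in> markov_extensions (bsc_joint q \<delta>)"
      "bernoulli_K \<beta> p \<le> arimoto_K \<beta> (law_WX R)"
      using s unfolding H_values_def le_iff[OF pos(1)] by blast
    then show ?thesis
      using bound by (simp only: le_iff[OF pos(2)])
  qed
  ultimately show ?thesis
    unfolding is_maximum_def by blast
qed

text \<open>As \<open>L_T\<close> is a \<open>LEAST\<close>, it is meaningful only where a minimum
  exists; the first conjunct secures this for every admissible x.\<close>

theorem theorem3:
  fixes \<delta> q \<beta> :: real
  assumes "0 \<le> \<delta>" "\<delta> \<le> 1" "0 \<le> q" "q \<le> 1 / 2" "2 \<le> \<beta>"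
  shows "(\<forall>x. bernoulli_K \<beta> q \<le> x \<and> x \<le> 1 \<longrightarrow> is_minimum (L_T \<beta> \<delta> q x) (K_values \<beta> \<delta> q x)) \<and>
    L_curve \<beta> \<delta> q = {(bernoulli_K \<beta> p, bernoulli_K \<beta> (p \<star> \<delta>)) | p. 0 \<le> p \<and> p \<le> q} \<and>
    (\<forall>(x, y) \<in> L_curve \<beta> \<delta> q.
       is_maximum (\<beta> / (1 - \<beta>) * ln y) (H_values \<beta> \<delta> q (\<beta> / (1 - \<beta>) * ln x)))"
proof -
  have min: "is_minimum (bernoulli_K \<beta> (p \<star> \<delta>)) (K_values \<beta> \<delta> q (bernoulli_K \<beta> p))" if "0 \<le> p" "p \<le> q" for p
    using K_values_minimum[of \<beta> \<delta> p q] that assms by simp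
  have L: "L_T \<beta> \<delta> q (bernoulli_K \<beta> p) = bernoulli_K \<beta> (p \<star> \<delta>)" if "0 \<le> p" "p \<le> q" for p
    using min[OF that] unfolding is_minimum_def L_T_def by (intro Least_equality) auto
  have "x \<in> {bernoulli_K \<beta> q..1} \<longleftrightarrow> x \<in> bernoulli_K \<beta> ` {0..q}" for x
    using bernoulli_K_image[of \<beta> q] assms by simp
  then have img: "bernoulli_K \<beta> q \<le> x \<and> x \<le> 1 \<longleftrightarrow> (\<exists>p. 0 \<le> p \<and> p \<le> q \<and> x = bernoulli_K \<beta> p)" for x
    by (simp add: image_iff Bex_def conj_assoc)
  have curve: "L_curve \<beta> \<delta> q = {(bernoulli_K \<beta> p, bernoulli_K \<beta> (p \<star> \<delta>)) | p. 0 \<le> p \<and> p \<le> q}"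
  proof -
    have "L_curve \<beta> \<delta> q = {(bernoulli_K \<beta> p, L_T \<beta> \<delta> q (bernoulli_K \<beta> p)) | p. 0 \<le> p \<and> p \<le> q}"
      unfolding L_curve_def img by auto
    also have "\<dots> = {(bernoulli_K \<beta> p, bernoulli_K \<beta> (p \<star> \<delta>)) | p. 0 \<le> p \<and> p \<le> q}"
      by (rule Collect_cong) (metis L)
    finally show ?thesis .
  qed
  show ?thesis
  proof (intro conjI allI impI)
    show "is_minimum (L_T \<beta> \<delta> q x) (K_values \<beta> \<delta> q x)" if "bernoulli_K \<beta> q \<le> x \<and> x \<le> 1" for x
      using that L min unfolding img by auto
    show "\<forall>(x, y) \<in> L_curve \<beta> \<delta> q.
       is_maximum (\<beta> / (1 - \<beta>) * ln y) (H_values \<beta> \<delta> q (\<beta> / (1 - \<beta>) * ln x))"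
      using H_values_maximum[OF assms(5,1,2) _ _ assms(4)] unfolding curve by auto
  qed (rule curve)
qed

end
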